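(* Let $s\in\mathbb{N}$, let $\Lambda$ be an $s$-dimensional index set, let $\mathcal{F}=\{\xi_{\mathbf k}:\mathbf k\in\Lambda\}$ be a uniform distribution determining (u.d.d.) function system on $[0,1)^s$, and let $\rho$ be a weight function on $\Lambda$. Let $\omega=(\mathbf x_n)_{n\ge 0}$ be a sequence in $[0,1)^s$, and for $N\in\mathbb{N}$ let $\sigma_N(\omega)$ be the spectral test of the first $N$ elements of $\omega$ with respect to $\mathcal{F}$ and $\rho$. Then: (1) For every $N\in\mathbb{N}$ the quantity $\sigma_N(\omega)$ is a maximum, i.e. the supremum $\sup_{\mathbf k\in\Lambda^*}\rho(\mathbf k)\,|S_N(\xi_{\mathbf k},\omega)|$ occurring in its definition is attained at some $\mathbf k\in\Lambda^*$. (2) The sequence $\omega$ is uniformly distributed in $[0,1)^s$ (uniformly distributed modulo one) if and only if $\lim_{N\to\infty}\sigma_N(\omega)=0$.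
   Context: $\mathbb{N}$ denotes the positive integers, $\mathbb{N}_0=\mathbb{N}\cup\{0\}$, and $\lambda_s$ is Lebesgue (Haar) measure on $[0,1)^s$. An $s$-dimensional index set $\Lambda$ is one of the additive semigroups $\mathbb{Z}^s$, $\mathbb{N}_0^s$, $\mathbb{N}^s$, or a finite direct product of such semigroups whose dimensions add up to $s$. Put $\Lambda^*=\Lambda\setminus\{\mathbf 0\}$. For $f:[0,1)^s\to\mathbb{C}$ and a sequence $\omega=(\mathbf x_n)_{n\ge0}$ in $[0,1)^s$, $S_N(f,\omega)=\frac1N\sum_{n=0}^{N-1}f(\mathbf x_n)$. A sequence $\omega$ is uniformly distributed in $[0,1)^s$ if $\lim_{N\to\infty}S_N(\mathbf 1_J-\lambda_s(J),\omega)=0$ for every interval $J=\prod_{i=1}^s[u_i,v_i)$ with $0\le u_i<v_i\le1$. A family $\mathcal{F}=\{\xi_{\mathbf k}:\mathbf k\in\Lambda\}$ of (complex-valued) Riemann integrable functions on $[0,1)^s$ is a u.d.d. function system if: $\sup_{\mathbf x\in[0,1)^s}|\xi_{\mathbf k}(\mathbf x)|\le1$ for all $\mathbf k\in\Lambda$; $\int_{[0,1)^s}\xi_{\mathbf k}\,d\lambda_s=0$ for all $\mathbf k\in\Lambda^*$; and for any sequence $\omega$ in $[0,1)^s$, the property that $\lim_{N\to\infty}S_N(\xi_{\mathbf k},\omega)=0$ for all $\mathbf k\in\Lambda^*$ implies that $\omega$ is uniformly distributed in $[0,1)^s$. Let $\|\cdot\|$ be an arbitrary norm on $\mathbb{R}^s$.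 A weight function on $\Lambda$ is a function $\rho:\Lambda\to\mathbb{R}$ with $\rho(\mathbf k)>0$ for all $\mathbf k\in\Lambda$, such that for every $\epsilon>0$ there is a positive real $K_0$ with $\rho(\mathbf k)<\epsilon$ for all $\mathbf k\in\Lambda$ with $\|\mathbf k\|>K_0$. The spectral test of the first $N$ elements of $\omega$ with respect to $\mathcal{F}$ and $\rho$ is $$\sigma_N(\omega)=\Big(\sup_{\mathbf k\in\Lambda^*}\rho(\mathbf k)\Big)^{-1}\sup_{\mathbf k\in\Lambda^*}\big\{\rho(\mathbf k)\,|S_N(\xi_{\mathbf k},\omega)|\big\}.$$ *)

theory Defs
  imports "HOL-Analysis.Analysis"
begin

text \<open>
  The dimension \<open>s\<close> is the cardinality of a finite type \<open>'s\<close>: points lie in \<open>real ^ 's\<close> and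
  multi-indices in \<open>int ^ 's\<close>. A family \<open>\<xi>\<close> and a weight \<open>\<rho>\<close> are total functions
  of which only the values on the index set (and on the unit cube) are ever used.
\<close>

definition half_open_box :: "real ^ 's \<Rightarrow> real ^ 's \<Rightarrow> (real ^ 's) set" where
  "half_open_box u v = {x. \<forall>i. u $ i \<le> x $ i \<and> x $ i < v $ i}"

definition unit_cube :: "(real ^ 's) set" where
  "unit_cube = half_open_box 0 1"

text \<open>
  Every factor \<open>\<int>\<^sup>d\<close>, \<open>\<nat>\<^sub>0\<^sup>d\<close>, \<open>\<nat>\<^sup>d\<close> of an index set is itself a product of
  one-dimensional factors, so an index set amounts to a choice of \<open>\<int>\<close>, \<open>\<nat>\<^sub>0\<close> or \<open>\<nat>\<close>
  in each coordinate.
\<close>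

definition index_set :: "(int ^ 's) set \<Rightarrow> bool" where
  "index_set \<Lambda> \<longleftrightarrow>
     (\<exists>A :: 's \<Rightarrow> int set.
        (\<forall>i. A i \<in> {UNIV, {0..}, {1..}}) \<and> \<Lambda> = {k. \<forall>i. k $ i \<in> A i})"

text \<open>For \<open>N = 0\<close> the value is \<open>0\<close>; only \<open>N \<ge> 1\<close> is meaningful.\<close>

definition seq_mean :: "nat \<Rightarrow> ('a \<Rightarrow> 'b::real_normed_field) \<Rightarrow> (nat \<Rightarrow> 'a) \<Rightarrow> 'b" where
  "seq_mean N f x = (1 / of_nat N) * (\<Sum>n<N. f (x n))"

definition uniformly_distributed :: "(nat \<Rightarrow> real ^ 's) \<Rightarrow> bool" where
  "uniformly_distributed x \<longleftrightarrow>
     (\<forall>u v. (\<forall>i. 0 \<le> u $ i \<and> u $ i < v $ i \<and> v $ i \<le> 1) \<longrightarrow>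
        (\<lambda>N. seq_mean N (\<lambda>y. indicator (half_open_box u v) y
                              - measure lebesgue (half_open_box u v)) x) \<longlonglongrightarrow> (0::real))"

text \<open>
  Riemann integrability on a closed box, by Riemann sums over tagged divisions with uniformly
  small cells (the gauge is a ball of constant radius, unlike for the Henstock-Kurzweil integral).
\<close>

definition Riemann_integrable_cbox ::
    "('a::euclidean_space \<Rightarrow> 'b::real_normed_vector) \<Rightarrow> 'a \<Rightarrow> 'a \<Rightarrow> bool" where
  "Riemann_integrable_cbox f a b \<longleftrightarrow>
     (\<exists>I. \<forall>e>0. \<exists>d>0. \<forall>p.
        p tagged_division_of cbox a b \<and> (\<lambda>x. ball x d) fine p \<longrightarrow>
        norm ((\<Sum>(x, K)\<in>p. measure lborel K *\<^sub>R f x) - I) < e)"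

text \<open>
  A function on the half-open cube is extended by zero to the closed cube. The values on the
  added faces do not affect Riemann integrability of a bounded function.
\<close>

definition Riemann_integrable_unit_cube :: "(real ^ 's \<Rightarrow> complex) \<Rightarrow> bool" where
  "Riemann_integrable_unit_cube f \<longleftrightarrow>
     Riemann_integrable_cbox (\<lambda>x. if x \<in> unit_cube then f x else 0) 0 1"

text \<open>
  The integral is taken with respect to \<^const>\<open>lebesgue\<close>, the completion of
  \<^const>\<open>lborel\<close>, because a Riemann integrable function need not be Borel measurable.
\<close>

definition udd_function_system :: "(int ^ 's) set \<Rightarrow> (int ^ 's \<Rightarrow> real ^ 's \<Rightarrow> complex) \<Rightarrow> bool" where
  "udd_function_system \<Lambda> \<xi> \<longleftrightarrow>
     (\<forall>k\<in>\<Lambda>. Riemann_integrable_unit_cube (\<xi> k)) \<and>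
     (\<forall>k\<in>\<Lambda>. \<forall>x\<in>unit_cube. norm (\<xi> k x) \<le> 1) \<and>
     (\<forall>k\<in>\<Lambda> - {0}. (LINT x:unit_cube|lebesgue. \<xi> k x) = 0) \<and>
     (\<forall>x. range x \<subseteq> unit_cube \<longrightarrow>
        (\<forall>k\<in>\<Lambda> - {0}. (\<lambda>N. seq_mean N (\<xi> k) x) \<longlonglongrightarrow> 0) \<longrightarrow>
        uniformly_distributed x)"

definition is_norm :: "('a::real_vector \<Rightarrow> real) \<Rightarrow> bool" where
  "is_norm \<nu> \<longleftrightarrow>
     (\<forall>x. 0 \<le> \<nu> x) \<and> (\<forall>x. \<nu> x = 0 \<longleftrightarrow> x = 0) \<and>
     (\<forall>c x. \<nu> (c *\<^sub>R x) = \<bar>c\<bar> * \<nu> x) \<and> (\<forall>x y. \<nu> (x + y) \<le> \<nu> x + \<nu> y)"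

definition weight_function ::
    "(real ^ 's \<Rightarrow> real) \<Rightarrow> (int ^ 's) set \<Rightarrow> (int ^ 's \<Rightarrow> real) \<Rightarrow> bool" where
  "weight_function \<nu> \<Lambda> \<rho> \<longleftrightarrow>
     (\<forall>k\<in>\<Lambda>. \<rho> k > 0) \<and>
     (\<forall>\<epsilon>>0. \<exists>K\<^sub>0>0. \<forall>k\<in>\<Lambda>. \<nu> (\<chi> i. real_of_int (k $ i)) > K\<^sub>0 \<longrightarrow> \<rho> k < \<epsilon>)"

definition spectral_test ::
    "(int ^ 's) set \<Rightarrow> (int ^ 's \<Rightarrow> real ^ 's \<Rightarrow> complex) \<Rightarrow> (int ^ 's \<Rightarrow> real) \<Rightarrow>
     nat \<Rightarrow> (nat \<Rightarrow> real ^ 's) \<Rightarrow> real" where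
  "spectral_test \<Lambda> \<xi> \<rho> N x =
     inverse (SUP k\<in>\<Lambda> - {0}. \<rho> k) * (SUP k\<in>\<Lambda> - {0}. \<rho> k * norm (seq_mean N (\<xi> k) x))"

end

theory Submission
  imports Defs
begin

text \<open>
  Since \<open>\<rho>\<close> tends to zero along \<open>\<Lambda>\<close> and the means are bounded by one, only finitely
  many indices compete for the supremum, so it is attained, and it tends to zero in \<open>N\<close> iff every
  single mean does. It remains that the means of a Riemann integrable \<open>f\<close> along a uniformly
  distributed sequence tend to the integral. Cut the cube into a fine grid of half-open boxes
  \<open>H\<^sub>j\<close>: the mean of \<open>f\<close> is \<open>\<Sum>\<^sub>j c\<^sub>j a\<^sub>j\<close> with \<open>c\<^sub>j\<close> the
  frequency of visits to \<open>H\<^sub>j\<close> and \<open>a\<^sub>j\<close> in the convex hull of \<open>f(H\<^sub>j)\<close>. The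
  frequencies tend to the volumes, and with the volumes in place of \<open>c\<^sub>j\<close> the sum lies in the
  convex hull of the Riemann sums of the grid, hence close to the integral.
\<close>

section \<open>Indices of large weight and attained suprema\<close>

text \<open>Compactness of the Euclidean unit sphere: \<open>\<nu>\<close> is continuous and attains
  a positive minimum there, which serves as \<open>c\<close>. Homogeneity extends the bound to all
  vectors.\<close>

lemma is_norm_lower_bound:
  fixes \<nu> :: "'a::euclidean_space \<Rightarrow> real"
  assumes "is_norm \<nu>"
  obtains c where "c > 0" "\<And>x. c * norm x \<le> \<nu> x"
proof -
  have nn: "0 \<le> \<nu> x" and z: "\<nu> x = 0 \<longleftrightarrow> x = 0" and sc: "\<nu> (c *\<^sub>R x) = \<bar>c\<bar> * \<nu> x"
    and tri: "\<nu> (x + y) \<le> \<nu> x + \<nu> y" for x y c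
    using assms unfolding is_norm_def by auto
  \<comment> \<open>Convexity is a short way to continuity: a convex function on an open set in
    finite dimension is continuous.\<close>
  have "convex_on UNIV \<nu>"
  proof (rule convex_onI)
    fix t :: real and x y assume "0 < t" "t < 1"
    then show "\<nu> ((1 - t) *\<^sub>R x + t *\<^sub>R y) \<le> (1 - t) * \<nu> x + t * \<nu> y"
      using tri[of "(1 - t) *\<^sub>R x" "t *\<^sub>R y"] by (simp add: sc)
  qed simp
  then have "continuous_on UNIV \<nu>"
    by (rule convex_on_continuous[OF open_UNIV])
  then have "continuous_on (sphere 0 1) \<nu>"
    by (rule continuous_on_subset) simp
  then obtain z where z1: "z \<in> sphere 0 1" and zmin: "\<And>y. y \<in> sphere 0 1 \<Longrightarrow> \<nu> z \<le> \<nu> y"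
    using continuous_attains_inf[of "sphere 0 1" \<nu>] by auto
  show thesis
  proof
    show "\<nu> z > 0"
      using nn[of z] z[of z] z1 by (cases "z = 0") auto
    show "\<nu> z * norm x \<le> \<nu> x" for x
    proof (cases "x = 0")
      case True
      then show ?thesis by (simp add: nn)
    next
      case False
      then have "\<nu> z \<le> \<nu> (inverse (norm x) *\<^sub>R x)"
        by (intro zmin) simp
      then show ?thesis
        using False by (simp add: sc field_simps)
    qed
  qed
qed

lemma finite_int_vec_norm_le:
  "finite {k :: int ^ 's. norm (\<chi> i. real_of_int (k $ i)) \<le> K}"
proof -
  let ?S = "{k :: int ^ 's. norm (\<chi> i. real_of_int (k $ i)) \<le> K}"
  have "?S \<subseteq> vec_lambda ` (PiE UNIV (\<lambda>_. {-\<lceil>K\<rceil>..\<lceil>K\<rceil>}))"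
  proof
    fix k assume "k \<in> ?S"
    then have "\<bar>real_of_int (k $ i)\<bar> \<le> K" for i
      using component_le_norm_cart[of "\<chi> i. real_of_int (k $ i)" i] by simp
    then have "k $ i \<in> {-\<lceil>K\<rceil>..\<lceil>K\<rceil>}" for i
      by (simp, smt (verit) le_of_int_ceiling of_int_le_iff of_int_minus)
    then have "vec_nth k \<in> PiE UNIV (\<lambda>_. {-\<lceil>K\<rceil>..\<lceil>K\<rceil>})"
      by auto
    then show "k \<in> vec_lambda ` (PiE UNIV (\<lambda>_. {-\<lceil>K\<rceil>..\<lceil>K\<rceil>}))"
      by (metis image_eqI vec_nth_inverse)
  qed
  then show ?thesis
    by (rule finite_subset) (simp add: finite_PiE)
qed

text \<open>The decay of \<open>\<rho>\<close> read contrapositively: a weight of at least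
  \<open>\<epsilon>\<close> confines the index to a ball for \<open>\<nu>\<close>, hence to a
  Euclidean ball, which holds only finitely many lattice points.\<close>

lemma weight_function_finite_ge:
  assumes "is_norm \<nu>" "weight_function \<nu> \<Lambda> \<rho>" "\<epsilon> > 0"
  shows "finite {k \<in> \<Lambda>. \<rho> k \<ge> \<epsilon>}"
proof -
  obtain c where c: "c > 0" "\<And>x. c * norm x \<le> \<nu> x"
    using is_norm_lower_bound[OF assms(1)] by blast
  obtain K where K: "\<forall>k\<in>\<Lambda>. \<nu> (\<chi> i. real_of_int (k $ i)) > K \<longrightarrow> \<rho> k < \<epsilon>"
    using assms unfolding weight_function_def by blast
  have "norm (\<chi> i. real_of_int (k $ i)) \<le> K / c" if "k \<in> \<Lambda>" "\<rho> k \<ge> \<epsilon>" for k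
  proof -
    have "\<nu> (\<chi> i. real_of_int (k $ i)) \<le> K"
      using K that by force
    then show ?thesis
      using c(2)[of "\<chi> i. real_of_int (k $ i)"] c(1) by (simp add: field_simps)
  qed
  then have "{k \<in> \<Lambda>. \<rho> k \<ge> \<epsilon>} \<subseteq> {k. norm (\<chi> i. real_of_int (k $ i)) \<le> K / c}"
    by blast
  then show ?thesis
    using finite_int_vec_norm_le finite_subset by blast
qed

text \<open>If some value is positive, the superlevel set at that value is finite and nonempty, and
  a maximum over it is a maximum over \<open>S\<close>. Otherwise \<open>h\<close> vanishes on
  \<open>S\<close> and every point is a maximum. Both \<open>\<rho>\<close> and the weighted means
  take the role of \<open>h\<close> later.\<close>

lemma attains_max_of_finite_superlevels:
  fixes h :: "'a \<Rightarrow> real"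
  assumes "S \<noteq> {}" and nonneg: "\<And>k. k \<in> S \<Longrightarrow> 0 \<le> h k"
    and fin: "\<And>e. e > 0 \<Longrightarrow> finite {k \<in> S. h k \<ge> e}"
  shows "\<exists>k\<in>S. (\<forall>l\<in>S. h l \<le> h k) \<and> (SUP l\<in>S. h l) = h k"
proof -
  have "\<exists>k\<in>S. \<forall>l\<in>S. h l \<le> h k"
  proof (cases "\<exists>k\<in>S. h k > 0")
    case True
    then obtain k0 where k0: "k0 \<in> S" "h k0 > 0" by blast
    let ?F = "{k \<in> S. h k \<ge> h k0}"
    have "finite ?F" "?F \<noteq> {}" using fin k0 by auto
    then have "Max (h ` ?F) \<in> h ` ?F" by (intro Max_in) auto
    then obtain k where "k \<in> ?F" "Max (h ` ?F) = h k" by blast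
    then have "h l \<le> h k" if "l \<in> ?F" for l
      using Max_ge[of "h ` ?F" "h l"] \<open>finite ?F\<close> that by auto
    then show ?thesis using \<open>k \<in> ?F\<close> by (intro bexI[of _ k]) force+
  next
    case False
    then have "\<And>l. l \<in> S \<Longrightarrow> h l \<le> 0" by (simp add: not_less)
    then show ?thesis using assms(1) nonneg by (meson all_not_in_conv order.trans)
  qed
  then obtain k where k: "k \<in> S" "\<And>l. l \<in> S \<Longrightarrow> h l \<le> h k" by blast
  then have "(SUP l\<in>S. h l) = h k"
    by (intro cSup_eq_maximum) auto
  then show ?thesis using k by blast
qed

section \<open>Volumes of boxes and convex hulls of values\<close>

text \<open>The two boxes differ only in faces, which are null sets. This links the volume in the
  definition of uniform distribution to the cell volumes in Riemann sums.\<close>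

lemma measure_half_open_box:
  "measure lebesgue (half_open_box u v) = measure lborel (cbox u v)"
proof -
  have "box u v \<subseteq> half_open_box u v" "half_open_box u v \<subseteq> cbox u v"
    by (auto simp: half_open_box_def mem_box_cart less_imp_le)
  then have "sym_diff (cbox u v) (half_open_box u v) \<subseteq> cbox u v - box u v"
    by auto
  then have "negligible (sym_diff (cbox u v) (half_open_box u v))"
    using negligible_frontier_interval negligible_subset by blast
  then have "measure lebesgue (half_open_box u v) = measure lebesgue (cbox u v)"
    by (rule measure_negligible_symdiff[rotated]) simp
  then show ?thesis by simp
qed

text \<open>The point \<open>a\<close> is the average of \<open>f\<close> over those of the first
  \<open>N\<close> terms of \<open>x\<close> that fall into \<open>H\<close>.\<close>

lemma sum_indicator_scaleR_convex_hull:
  fixes f :: "'a \<Rightarrow> 'b::real_vector"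
  assumes "H \<noteq> {}"
  obtains a where "a \<in> convex hull (f ` H)"
    "(\<Sum>n<(N::nat). indicator H (x n) *\<^sub>R f (x n)) = (\<Sum>n<N. indicator H (x n)) *\<^sub>R a"
proof -
  define S where "S = {n. n < N \<and> x n \<in> H}"
  have fin: "finite S" unfolding S_def by simp
  have lhs: "(\<Sum>n<N. indicator H (x n) *\<^sub>R f (x n)) = (\<Sum>n\<in>S. f (x n))"
    unfolding S_def by (rule sum.mono_neutral_cong_right) (auto simp: indicator_def)
  have "(\<Sum>n<N. indicator H (x n)) = (\<Sum>n\<in>S. 1::real)"
    unfolding S_def by (rule sum.mono_neutral_cong_right) (auto simp: indicator_def)
  then have card: "(\<Sum>n<N. indicator H (x n)) = real (card S)" by simp
  show thesis
  proof (cases "S = {}")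
    \<comment> \<open>Without visits to \<open>H\<close> both sides vanish, so any value of
      \<open>f\<close> on \<open>H\<close> will do.\<close>
    case True
    obtain h where "h \<in> H" using assms by blast
    then have "f h \<in> convex hull (f ` H)" by (intro hull_inc) simp
    then show thesis by (rule that) (simp add: lhs card True)
  next
    case False
    have "(\<Sum>n\<in>S. (1 / real (card S)) *\<^sub>R f (x n)) \<in> convex hull (f ` H)"
      using fin False by (intro convex_sum) (auto simp: S_def intro!: hull_inc)
    then show thesis
      by (rule that) (use fin False in \<open>simp add: lhs card flip: scaleR_sum_right\<close>)
  qed
qed

text \<open>An average of a complex function over a cell need not be one of its values, so what is
  known for sums of values must be carried over to points of the hulls. This works because taking
  convex hulls commutes with scaling and with finite Minkowski sums.\<close>

lemma sum_convex_hull_in_convex: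
  fixes A :: "'i \<Rightarrow> 'b::real_vector set"
  assumes "finite J" "convex C"
    and C: "\<And>b. (\<And>j. j \<in> J \<Longrightarrow> b j \<in> A j) \<Longrightarrow> (\<Sum>j\<in>J. w j *\<^sub>R b j) \<in> C"
    and a: "\<And>j. j \<in> J \<Longrightarrow> a j \<in> convex hull (A j)"
  shows "(\<Sum>j\<in>J. w j *\<^sub>R a j) \<in> C"
proof -
  let ?B = "\<lambda>j. (*\<^sub>R) (w j) ` A j"
  have "(\<Sum>j\<in>J. ?B j) \<subseteq> C"
  proof
    fix y assume "y \<in> (\<Sum>j\<in>J. ?B j)"
    then obtain s where y: "y = sum s J" and s: "\<forall>j\<in>J. s j \<in> ?B j"
      using set_sum_alt[OF assms(1), of ?B] by blast
    then have "\<forall>j\<in>J. \<exists>b. b \<in> A j \<and> s j = w j *\<^sub>R b" by blast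
    from bchoice[OF this] obtain b where "\<forall>j\<in>J. b j \<in> A j \<and> s j = w j *\<^sub>R b j"
      by blast
    then show "y \<in> C" using C[of b] by (simp add: y)
  qed
  then have "convex hull (\<Sum>j\<in>J. ?B j) \<subseteq> C"
    using assms(2) by (rule hull_minimal)
  moreover have "(\<Sum>j\<in>J. w j *\<^sub>R a j) \<in> (\<Sum>j\<in>J. convex hull (?B j))"
    using a by (subst set_sum_alt[OF assms(1)]) (auto simp: convex_hull_scaling)
  ultimately show ?thesis
    by (auto simp: convex_hull_set_sum)
qed

section \<open>The grid of cubes of side \<open>1 / m\<close>\<close>

text \<open>For \<open>m > 0\<close> and indices below \<open>m\<close> the half-open boxes
  partition the unit cube and have the shape that uniform distribution tests; their closed versions
  serve as cells of a tagged division.\<close>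

definition grid_box :: "nat \<Rightarrow> ('s \<Rightarrow> nat) \<Rightarrow> (real ^ 's) set" where
  "grid_box m j = half_open_box (\<chi> i. j i / m) (\<chi> i. (real (j i) + 1) / m)"

definition grid_cbox :: "nat \<Rightarrow> ('s \<Rightarrow> nat) \<Rightarrow> (real ^ 's) set" where
  "grid_cbox m j = cbox (\<chi> i. j i / m) (\<chi> i. (real (j i) + 1) / m)"

abbreviation grid_index :: "nat \<Rightarrow> ('s::finite \<Rightarrow> nat) set" where
  "grid_index m \<equiv> PiE UNIV (\<lambda>_. {..<m})"

text \<open>Multiplied by \<open>m\<close>, the two inequalities say what the floor is, so a point
  determines its box. The sign condition is there because \<open>nat\<close> sends negative floors
  to 0.\<close>

lemma mem_grid_box:
  assumes "m > 0"
  shows "x \<in> grid_box m j \<longleftrightarrow> (\<forall>i. 0 \<le> x $ i \<and> nat \<lfloor>m * x $ i\<rfloor> = j i)"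
proof -
  have "j i / m \<le> x $ i \<and> x $ i < (real (j i) + 1) / m \<longleftrightarrow> 0 \<le> x $ i \<and> nat \<lfloor>m * x $ i\<rfloor> = j i" for i
  proof -
    have "j i / m \<le> x $ i \<and> x $ i < (real (j i) + 1) / m \<longleftrightarrow> real (j i) \<le> m * x $ i \<and> m * x $ i < real (j i) + 1"
      using assms by (simp add: field_simps)
    also have "\<dots> \<longleftrightarrow> \<lfloor>m * x $ i\<rfloor> = int (j i)"
      by (simp add: floor_eq_iff)
    also have "\<dots> \<longleftrightarrow> 0 \<le> m * x $ i \<and> nat \<lfloor>m * x $ i\<rfloor> = j i"
      by (smt (verit) floor_less_zero nat_eq_iff of_nat_0_le_iff zero_le_floor)
    finally show ?thesis
      using assms by (simp add: zero_le_mult_iff)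
  qed
  then show ?thesis
    by (simp add: grid_box_def half_open_box_def)
qed

lemma mem_unit_cube: "x \<in> unit_cube \<longleftrightarrow> (\<forall>i. 0 \<le> x $ i \<and> x $ i < 1)"
  by (simp add: unit_cube_def half_open_box_def)

lemma ex1_grid_box:
  assumes "m > 0" "x \<in> unit_cube"
  shows "\<exists>!j. j \<in> grid_index m \<and> x \<in> grid_box m j"
proof -
  have "nat \<lfloor>m * x $ i\<rfloor> < m" for i
  proof -
    have "m * x $ i < real m" using assms by (simp add: mem_unit_cube)
    then have "\<lfloor>m * x $ i\<rfloor> < int m" by (simp only: floor_less_iff of_int_of_nat_eq)
    then show ?thesis using assms(1) by linarith
  qed
  then show ?thesis
    using assms by (intro ex1I[of _ "\<lambda>i. nat \<lfloor>m * x $ i\<rfloor>"]) (auto simp: mem_grid_box mem_unit_cube)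
qed

lemma grid_box_subset_unit_cube:
  assumes "m > 0" "j \<in> grid_index m"
  shows "grid_box m j \<subseteq> unit_cube"
proof
  fix x assume x: "x \<in> grid_box m j"
  have "x $ i < 1" for i
  proof -
    have "j i < m" using assms by auto
    then have "real (j i) + 1 \<le> m" by linarith
    then have "(real (j i) + 1) / m \<le> 1" using assms(1) by simp
    moreover have "x $ i < (real (j i) + 1) / m"
      using x by (simp add: grid_box_def half_open_box_def)
    ultimately show ?thesis by linarith
  qed
  then show "x \<in> unit_cube"
    using x assms by (simp add: mem_unit_cube mem_grid_box)
qed

lemma grid_box_subset_grid_cbox: "grid_box m j \<subseteq> grid_cbox m j"
  by (auto simp: grid_box_def grid_cbox_def half_open_box_def mem_box_cart less_imp_le)

lemma interior_grid_cbox_subset: "interior (grid_cbox m j) \<subseteq> grid_box m j"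
  by (auto simp: grid_box_def grid_cbox_def half_open_box_def mem_box_cart interior_cbox less_imp_le)

lemma grid_cbox_cover:
  assumes "m > 0"
  shows "(\<Union>j\<in>grid_index m. grid_cbox m j) = (cbox 0 1 :: (real ^ 's) set)"
proof
  show "(\<Union>j\<in>grid_index m. grid_cbox m j) \<subseteq> (cbox 0 1 :: (real ^ 's) set)"
  proof clarify
    fix j :: "'s \<Rightarrow> nat" and x assume j: "j \<in> grid_index m" and x: "x \<in> grid_cbox m j"
    have "0 \<le> x $ i \<and> x $ i \<le> 1" for i
    proof -
      have "j i < m" using j by auto
      then have "real (j i) + 1 \<le> m" by linarith
      then have "(real (j i) + 1) / m \<le> 1" using assms(1) by simp
      moreover have "x $ i \<le> (real (j i) + 1) / m" "j i / m \<le> x $ i"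
        using x by (simp_all add: grid_cbox_def mem_box_cart)
      moreover have "0 \<le> j i / m" by simp
      ultimately show ?thesis by linarith
    qed
    then show "x \<in> cbox 0 1" by (simp add: mem_box_cart)
  qed
  show "(cbox 0 1 :: (real ^ 's) set) \<subseteq> (\<Union>j\<in>grid_index m. grid_cbox m j)"
  proof
    fix x :: "real ^ 's" assume x: "x \<in> cbox 0 1"
    \<comment> \<open>Where a coordinate equals 1 the floor would give \<open>m\<close>, one past
      the last index, so the last closed cell takes such points.\<close>
    define j where "j i = (if x $ i = 1 then m - 1 else nat \<lfloor>m * x $ i\<rfloor>)" for i
    have "j i < m \<and> j i / m \<le> x $ i \<and> x $ i \<le> (real (j i) + 1) / m" for i
    proof (cases "x $ i = 1")
      case True
      then show ?thesis using assms by (simp add: j_def of_nat_diff field_simps)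
    next
      case False
      then have xi: "0 \<le> x $ i" "x $ i < 1" using x by (auto simp: mem_box_cart less_le)
      then have "m * x $ i < real m" using assms by simp
      then have "\<lfloor>m * x $ i\<rfloor> < int m" by (simp only: floor_less_iff of_int_of_nat_eq)
      then have "nat \<lfloor>m * x $ i\<rfloor> < m" using assms by linarith
      moreover have "real (nat \<lfloor>m * x $ i\<rfloor>) \<le> m * x $ i" "m * x $ i \<le> nat \<lfloor>m * x $ i\<rfloor> + 1"
        using xi assms by (simp_all add: of_nat_nat floor_le_iff) linarith+
      ultimately show ?thesis using False assms by (simp add: j_def field_simps)
    qed
    then show "x \<in> (\<Union>j\<in>grid_index m. grid_cbox m j)"
      by (intro UN_I[of j]) (auto simp: grid_cbox_def mem_box_cart)
  qed
qed

lemma grid_tagged_division: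
  fixes t :: "('s::finite \<Rightarrow> nat) \<Rightarrow> real ^ 's"
  assumes "m > 0" and t: "\<And>j. j \<in> grid_index m \<Longrightarrow> t j \<in> grid_box m j"
  shows "(\<lambda>j. (t j, grid_cbox m j)) ` grid_index m tagged_division_of cbox 0 1"
proof (rule tagged_division_ofI)
  show "finite ((\<lambda>j. (t j, grid_cbox m j)) ` grid_index m)"
    by (simp add: finite_PiE)
  show "x \<in> K" if "(x, K) \<in> (\<lambda>j. (t j, grid_cbox m j)) ` grid_index m" for x K
    using that t grid_box_subset_grid_cbox by fastforce
  show "K \<subseteq> cbox 0 1" if "(x, K) \<in> (\<lambda>j. (t j, grid_cbox m j)) ` grid_index m" for x K
    using that grid_cbox_cover[OF assms(1), where 's = 's] by blast
  show "\<exists>a b. K = cbox a b" if "(x, K) \<in> (\<lambda>j. (t j, grid_cbox m j)) ` grid_index m" for x K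
    using that unfolding grid_cbox_def by blast
  show "interior K1 \<inter> interior K2 = {}"
    if K: "(x1, K1) \<in> (\<lambda>j. (t j, grid_cbox m j)) ` grid_index m"
      "(x2, K2) \<in> (\<lambda>j. (t j, grid_cbox m j)) ` grid_index m" "(x1, K1) \<noteq> (x2, K2)" for x1 K1 x2 K2
  proof -
    obtain j1 j2 where "j1 \<in> grid_index m" "j2 \<in> grid_index m" "j1 \<noteq> j2"
      "K1 = grid_cbox m j1" "K2 = grid_cbox m j2"
      using K by blast
    \<comment> \<open>Disjointness of the half-open boxes passes to the interiors of the closed
      cells, which lie inside them.\<close>
    moreover have "grid_box m j1 \<inter> grid_box m j2 = {}"
      using \<open>j1 \<noteq> j2\<close> by (auto simp: mem_grid_box[OF assms(1)])
    ultimately show ?thesis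
      using interior_grid_cbox_subset by blast
  qed
  show "\<Union>{K. \<exists>x. (x, K) \<in> (\<lambda>j. (t j, grid_cbox m j)) ` grid_index m} = cbox 0 1"
    unfolding grid_cbox_cover[OF assms(1), symmetric] by blast
qed

text \<open>The factor \<open>CARD('s)\<close> arises from bounding the Euclidean norm by the sum of
  the coordinate distances, each at most \<open>1 / m\<close>.\<close>

lemma grid_cbox_subset_ball:
  assumes "real CARD('s) / m < d" "x \<in> grid_cbox m j"
  shows "grid_cbox m j \<subseteq> ball (x :: real ^ 's) d"
proof
  fix y assume y: "y \<in> grid_cbox m j"
  have "\<bar>(x - y) $ i\<bar> \<le> 1 / m" for i
  proof -
    have "j i / m \<le> x $ i" "x $ i \<le> j i / m + 1 / m" "j i / m \<le> y $ i" "y $ i \<le> j i / m + 1 / m"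
      using y assms(2) by (simp_all add: grid_cbox_def mem_box_cart add_divide_distrib)
    then show ?thesis unfolding vector_minus_component by linarith
  qed
  then have "(\<Sum>i\<in>UNIV. \<bar>(x - y) $ i\<bar>) \<le> (\<Sum>i\<in>(UNIV::'s set). 1 / m)"
    by (rule sum_mono)
  then have "norm (x - y) \<le> real CARD('s) / m"
    using norm_le_l1_cart[of "x - y"] by simp
  then show "y \<in> ball x d"
    using assms(1) by (simp add: dist_norm)
qed

section \<open>Means along uniformly distributed sequences\<close>

lemma uniformly_distributed_grid_frequency:
  assumes ud: "uniformly_distributed x" and "m > 0" "j \<in> grid_index m"
  shows "(\<lambda>N. seq_mean N (indicator (grid_box m j)) x) \<longlonglongrightarrow> measure lborel (grid_cbox m j)"
proof -
  let ?u = "\<chi> i. j i / m" and ?v = "\<chi> i. (real (j i) + 1) / m"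
  have "j i < m" for i using assms(3) by auto
  then have "real (j i) + 1 \<le> m" for i by (metis Suc_eq_plus1 Suc_leI of_nat_1 of_nat_add of_nat_le_iff)
  then have "\<forall>i. 0 \<le> ?u $ i \<and> ?u $ i < ?v $ i \<and> ?v $ i \<le> 1"
    using assms(2) by (simp add: divide_strict_right_mono)
  then have "(\<lambda>N. seq_mean N (\<lambda>y. indicator (half_open_box ?u ?v) y
               - measure lebesgue (half_open_box ?u ?v)) x) \<longlonglongrightarrow> (0::real)"
    using ud unfolding uniformly_distributed_def by blast
  then have lim: "(\<lambda>N. seq_mean N (\<lambda>y. indicator (grid_box m j) y - measure lborel (grid_cbox m j)) x)
      \<longlonglongrightarrow> (0::real)"
    by (simp only: measure_half_open_box grid_box_def grid_cbox_def)
  have "(\<lambda>N. seq_mean N (indicator (grid_box m j)) x - measure lborel (grid_cbox m j)) \<longlonglongrightarrow> (0::real)"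
  proof (rule Lim_transform_eventually[OF lim])
    show "\<forall>\<^sub>F N in sequentially. seq_mean N (\<lambda>y. indicator (grid_box m j) y - measure lborel (grid_cbox m j)) x
        = seq_mean N (indicator (grid_box m j)) x - measure lborel (grid_cbox m j)"
      \<comment> \<open>At \<open>N = 0\<close> the mean is 0 by convention and the constant does
        not split off, so only positive \<open>N\<close> are compared.\<close>
      using eventually_gt_at_top[of 0]
      by eventually_elim (simp add: seq_mean_def sum_subtractf field_simps)
  qed
  then show ?thesis by (rule LIM_zero_cancel)
qed

text \<open>The grid is fine for balls of radius \<open>d\<close> by the choice of \<open>m\<close>.
  Tags in the half-open boxes lie in the unit cube, so the extension by zero does not alter their
  values.\<close>

lemma Riemann_sums_grid:
  fixes f :: "real ^ 's \<Rightarrow> complex"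
  assumes "\<forall>p. p tagged_division_of cbox 0 1 \<and> (\<lambda>x. ball x d) fine p \<longrightarrow>
      norm ((\<Sum>(x, K)\<in>p. measure lborel K *\<^sub>R (if x \<in> unit_cube then f x else 0)) - I) < e"
    and m: "m > 0" "real CARD('s) / m < d"
    and t: "\<And>j. j \<in> grid_index m \<Longrightarrow> t j \<in> grid_box m j"
  shows "norm ((\<Sum>j\<in>grid_index m. measure lborel (grid_cbox m j) *\<^sub>R f (t j)) - I) < e"
proof -
  let ?g = "\<lambda>j. (t j, grid_cbox m j)"
  \<comment> \<open>A Riemann sum runs over a set of pairs; injectivity turns it into a sum over
    indices. It holds because a tag determines its box.\<close>
  have "inj_on ?g (grid_index m)"
  proof (rule inj_onI)
    fix j1 j2 assume "j1 \<in> grid_index m" "j2 \<in> grid_index m" "?g j1 = ?g j2"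
    then have "t j1 \<in> grid_box m j1" "t j1 \<in> grid_box m j2"
      using t[of j1] t[of j2] by auto
    then show "j1 = j2" by (auto simp: mem_grid_box[OF m(1)])
  qed
  then have "(\<Sum>(x, K)\<in>?g ` grid_index m. measure lborel K *\<^sub>R (if x \<in> unit_cube then f x else 0))
      = (\<Sum>j\<in>grid_index m. measure lborel (grid_cbox m j) *\<^sub>R (if t j \<in> unit_cube then f (t j) else 0))"
    by (subst sum.reindex) simp_all
  also have "\<dots> = (\<Sum>j\<in>grid_index m. measure lborel (grid_cbox m j) *\<^sub>R f (t j))"
    using t grid_box_subset_unit_cube[OF m(1)] by (intro sum.cong) auto
  finally have eq: "(\<Sum>(x, K)\<in>?g ` grid_index m. measure lborel K *\<^sub>R (if x \<in> unit_cube then f x else 0))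
      = (\<Sum>j\<in>grid_index m. measure lborel (grid_cbox m j) *\<^sub>R f (t j))" .
  have division: "?g ` grid_index m tagged_division_of cbox 0 1"
    using grid_tagged_division[OF m(1) t] .
  have fine: "(\<lambda>x. ball x d) fine ?g ` grid_index m"
  proof (rule fineI)
    fix x K assume "(x, K) \<in> ?g ` grid_index m"
    then obtain j where j: "j \<in> grid_index m" "x = t j" "K = grid_cbox m j" by auto
    then have "x \<in> grid_cbox m j" using t grid_box_subset_grid_cbox by blast
    then show "K \<subseteq> ball x d" using grid_cbox_subset_ball[OF m(2)] j(3) by blast
  qed
  show ?thesis
    using assms(1)[rule_format, OF conjI[OF division fine]] unfolding eq .
qed

lemma grid_box_nonempty:
  assumes "m > 0"
  shows "grid_box m j \<noteq> {}"
proof -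
  have "(\<chi> i. j i / m) \<in> grid_box m j"
    using assms by (simp add: grid_box_def half_open_box_def divide_strict_right_mono)
  then show ?thesis by blast
qed

text \<open>A ball of constant radius is a gauge, so the Riemann limit is the Henstock-Kurzweil
  integral. Boundedness makes the function absolutely integrable, and there that integral agrees
  with the Lebesgue integral.\<close>

lemma Riemann_sums_converge_to_lebesgue_integral:
  fixes f :: "real ^ 's \<Rightarrow> complex"
  assumes f: "Riemann_integrable_unit_cube f" and B: "\<And>x. x \<in> unit_cube \<Longrightarrow> norm (f x) \<le> B"
  shows "\<forall>e>0. \<exists>d>0. \<forall>p. p tagged_division_of cbox 0 1 \<and> (\<lambda>x. ball x d) fine p \<longrightarrow>
      norm ((\<Sum>(x, K)\<in>p. measure lborel K *\<^sub>R (if x \<in> unit_cube then f x else 0))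
        - (LINT x:unit_cube|lebesgue. f x)) < e"
proof -
  let ?f = "\<lambda>x. if x \<in> unit_cube then f x else 0"
  obtain I where I: "\<forall>e>0. \<exists>d>0. \<forall>p. p tagged_division_of cbox 0 1 \<and> (\<lambda>x. ball x d) fine p \<longrightarrow>
      norm ((\<Sum>(x, K)\<in>p. measure lborel K *\<^sub>R ?f x) - I) < e"
    using f unfolding Riemann_integrable_unit_cube_def Riemann_integrable_cbox_def by (elim exE)
  have int: "(?f has_integral I) (cbox 0 1)"
    unfolding has_integral
  proof (intro allI impI)
    fix e :: real assume "e > 0"
    from I[rule_format, OF this] obtain d where d: "d > 0" "\<forall>p. p tagged_division_of cbox 0 1 \<and> (\<lambda>x. ball x d) fine p \<longrightarrow>
        norm ((\<Sum>(x, K)\<in>p. measure lborel K *\<^sub>R ?f x) - I) < e"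
      by (elim exE conjE) (rule that)
    show "\<exists>\<gamma>. gauge \<gamma> \<and> (\<forall>p. p tagged_division_of cbox 0 1 \<and> \<gamma> fine p \<longrightarrow>
        norm ((\<Sum>(x, K)\<in>p. measure lborel K *\<^sub>R ?f x) - I) < e)"
      by (rule exI[of _ "\<lambda>x. ball x d"], rule conjI[OF gauge_ball[OF d(1)] d(2)])
  qed
  have abs: "?f absolutely_integrable_on cbox 0 1"
  proof (rule absolutely_integrable_integrable_bound)
    show "norm (?f x) \<le> \<bar>B\<bar>" for x
      using B[of x] by auto
    show "?f integrable_on cbox 0 1"
      by (rule has_integral_integrable[OF int])
    show "(\<lambda>x. \<bar>B\<bar>) integrable_on cbox (0::real^'s) 1"
      by (rule integrable_const)
  qed
  have "(LINT x:cbox 0 1|lebesgue. ?f x) = I"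
    using set_lebesgue_integral_eq_integral(2)[OF abs] integral_unique[OF int] by (rule trans)
  \<comment> \<open>The extension vanishes on the added faces, so the integrands over the closed and
    the half-open cube coincide pointwise.\<close>
  moreover have "indicator (cbox 0 1) x *\<^sub>R ?f x = indicator unit_cube x *\<^sub>R f x" for x
    by (auto simp: indicator_def mem_unit_cube mem_box_cart less_imp_le)
  ultimately have "(LINT x:unit_cube|lebesgue. f x) = I"
    unfolding set_lebesgue_integral_def by simp
  then show ?thesis using I by (simp only:)
qed

text \<open>The error \<open>e\<close> is split in two: one half for the distance of the Riemann
  sums from the integral, which fixes the grid, the other for replacing frequencies by volumes,
  which fixes how large \<open>N\<close> must be.\<close>

lemma uniformly_distributed_mean_tendsto:
  fixes f :: "real ^ 's \<Rightarrow> complex"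
  assumes ud: "uniformly_distributed x" and x: "range x \<subseteq> unit_cube"
    and f: "Riemann_integrable_unit_cube f" and B: "\<And>x. x \<in> unit_cube \<Longrightarrow> norm (f x) \<le> B"
  shows "(\<lambda>N. seq_mean N f x) \<longlonglongrightarrow> (LINT x:unit_cube|lebesgue. f x)"
proof (rule metric_LIMSEQ_I)
  fix e :: real assume e: "e > 0"
  define I where "I = (LINT x:unit_cube|lebesgue. f x)"
  have "\<forall>e>0. \<exists>d>0. \<forall>p. p tagged_division_of cbox 0 1 \<and> (\<lambda>x. ball x d) fine p \<longrightarrow>
      norm ((\<Sum>(x, K)\<in>p. measure lborel K *\<^sub>R (if x \<in> unit_cube then f x else 0)) - I) < e"
    unfolding I_def by (rule Riemann_sums_converge_to_lebesgue_integral[OF f B])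
  from this[rule_format, OF half_gt_zero[OF e]]
  obtain d where d: "d > 0" "\<forall>p. p tagged_division_of cbox 0 1 \<and> (\<lambda>x. ball x d) fine p \<longrightarrow>
      norm ((\<Sum>(x, K)\<in>p. measure lborel K *\<^sub>R (if x \<in> unit_cube then f x else 0)) - I) < e / 2"
    by (elim exE conjE) (rule that)
  obtain m :: nat where "real CARD('s) / d < m"
    using reals_Archimedean2 by blast
  moreover from this have m: "m > 0"
    using d(1) by (smt (verit) divide_nonneg_pos of_nat_0_le_iff of_nat_0_less_iff)
  ultimately have md: "real CARD('s) / m < d"
    using d(1) by (simp add: field_simps)
  let ?J = "grid_index m :: ('s \<Rightarrow> nat) set"
  define w where "w j = measure lborel (grid_cbox m j)" for j :: "'s \<Rightarrow> nat"
  define c where "c N j = seq_mean N (indicator (grid_box m j) :: _ \<Rightarrow> real) x" for N and j :: "'s \<Rightarrow> nat"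
  have finJ: "finite ?J" by (simp add: finite_PiE)
  \<comment> \<open>The hull points \<open>a j\<close> chosen below depend on \<open>N\<close>.
    Their common bound \<open>B\<close> does not, so \<open>M\<close> can be fixed before
    them.\<close>
  have "(\<lambda>N. \<Sum>j\<in>?J. \<bar>c N j - w j\<bar> * B) \<longlonglongrightarrow> (\<Sum>j\<in>?J. \<bar>w j - w j\<bar> * B)"
    unfolding c_def w_def
    by (intro tendsto_intros uniformly_distributed_grid_frequency ud m) simp
  then have "(\<lambda>N. \<Sum>j\<in>?J. \<bar>c N j - w j\<bar> * B) \<longlonglongrightarrow> 0" by simp
  then have "\<forall>\<^sub>F N in sequentially. (\<Sum>j\<in>?J. \<bar>c N j - w j\<bar> * B) < e / 2"
    using e by (intro order_tendstoD) auto
  then obtain M where M: "\<And>N. N \<ge> M \<Longrightarrow> (\<Sum>j\<in>?J. \<bar>c N j - w j\<bar> * B) < e / 2"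
    unfolding eventually_sequentially by blast
  have "dist (seq_mean N f x) I < e" if N: "N \<ge> M" for N
  proof -
    have "\<exists>a. \<forall>j. a j \<in> convex hull (f ` grid_box m j) \<and>
       (\<Sum>n<N. indicator (grid_box m j) (x n) *\<^sub>R f (x n)) = (\<Sum>n<N. indicator (grid_box m j) (x n)) *\<^sub>R a j"
    proof (intro choice allI)
      fix j :: "'s \<Rightarrow> nat"
      obtain a where "a \<in> convex hull (f ` grid_box m j)"
        "(\<Sum>n<N. indicator (grid_box m j) (x n) *\<^sub>R f (x n)) = (\<Sum>n<N. indicator (grid_box m j) (x n)) *\<^sub>R a"
        by (rule sum_indicator_scaleR_convex_hull[OF grid_box_nonempty[OF m]])
      then show "\<exists>a. a \<in> convex hull (f ` grid_box m j) \<and>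
        (\<Sum>n<N. indicator (grid_box m j) (x n) *\<^sub>R f (x n)) = (\<Sum>n<N. indicator (grid_box m j) (x n)) *\<^sub>R a"
        by blast
    qed
    then obtain a where a: "\<And>j. a j \<in> convex hull (f ` grid_box m j)"
      "\<And>j. (\<Sum>n<N. indicator (grid_box m j) (x n) *\<^sub>R f (x n)) = (\<Sum>n<N. indicator (grid_box m j) (x n)) *\<^sub>R a j"
      by blast
    have split: "f y = (\<Sum>j\<in>?J. indicator (grid_box m j) y *\<^sub>R f y)" if y: "y \<in> unit_cube" for y
    proof -
      obtain j0 where j0: "j0 \<in> ?J" "y \<in> grid_box m j0"
        and uniq: "\<And>j. j \<in> ?J \<Longrightarrow> y \<in> grid_box m j \<Longrightarrow> j = j0"
        using ex1_grid_box[OF m y] by blast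
      have "(\<Sum>j\<in>?J. indicator (grid_box m j) y *\<^sub>R f y) = (\<Sum>j\<in>{j0}. indicator (grid_box m j) y *\<^sub>R f y)"
      proof (rule sum.mono_neutral_right[OF finJ])
        show "{j0} \<subseteq> ?J" using j0(1) by blast
        show "\<forall>j\<in>?J - {j0}. indicator (grid_box m j) y *\<^sub>R f y = 0"
          using uniq by (metis Diff_iff indicator_simps(2) insertI1 scaleR_zero_left)
      qed
      then show ?thesis using j0 by simp
    qed
    have "(\<Sum>n<N. f (x n)) = (\<Sum>n<N. \<Sum>j\<in>?J. indicator (grid_box m j) (x n) *\<^sub>R f (x n))"
      using x by (intro sum.cong refl split) blast
    also have "\<dots> = (\<Sum>j\<in>?J. (\<Sum>n<N. indicator (grid_box m j) (x n)) *\<^sub>R a j)"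
      by (subst sum.swap) (simp add: a(2))
    finally have "seq_mean N f x = (1 / real N) *\<^sub>R (\<Sum>j\<in>?J. (\<Sum>n<N. indicator (grid_box m j) (x n)) *\<^sub>R a j)"
      by (simp add: seq_mean_def scaleR_conv_of_real)
    then have mean: "seq_mean N f x = (\<Sum>j\<in>?J. c N j *\<^sub>R a j)"
      by (simp add: c_def seq_mean_def scaleR_sum_right)
    have aB: "norm (a j) \<le> B" if "j \<in> ?J" for j
    proof -
      have "f ` grid_box m j \<subseteq> cball 0 B"
        using B grid_box_subset_unit_cube[OF m that] by auto
      then have "convex hull (f ` grid_box m j) \<subseteq> cball 0 B"
        by (rule hull_minimal) simp
      then show ?thesis using a(1)[of j] by auto
    qed
    \<comment> \<open>With genuine values of \<open>f\<close> in place of \<open>a\<close> this is a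
      Riemann sum of the grid; convexity of the ball allows hull points.\<close>
    have "(\<Sum>j\<in>?J. w j *\<^sub>R a j) \<in> ball I (e / 2)"
    proof (rule sum_convex_hull_in_convex[OF finJ convex_ball])
      fix b assume "\<And>j. j \<in> ?J \<Longrightarrow> b j \<in> f ` grid_box m j"
      then have "\<forall>j\<in>?J. \<exists>t. t \<in> grid_box m j \<and> b j = f t" by blast
      from bchoice[OF this] obtain t
        where t: "\<And>j. j \<in> ?J \<Longrightarrow> t j \<in> grid_box m j" "\<And>j. j \<in> ?J \<Longrightarrow> b j = f (t j)"
        by blast
      have "norm ((\<Sum>j\<in>?J. w j *\<^sub>R f (t j)) - I) < e / 2"
        unfolding w_def by (rule Riemann_sums_grid[OF d(2) m md t(1)])
      then show "(\<Sum>j\<in>?J. w j *\<^sub>R b j) \<in> ball I (e / 2)"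
        by (simp add: t(2) dist_norm norm_minus_commute)
    qed (rule a(1))
    then have 1: "norm ((\<Sum>j\<in>?J. w j *\<^sub>R a j) - I) < e / 2"
      by (simp add: dist_norm norm_minus_commute)
    have "norm (seq_mean N f x - (\<Sum>j\<in>?J. w j *\<^sub>R a j)) = norm (\<Sum>j\<in>?J. (c N j - w j) *\<^sub>R a j)"
      by (simp add: mean sum_subtractf scaleR_diff_left)
    also have "\<dots> \<le> (\<Sum>j\<in>?J. \<bar>c N j - w j\<bar> * B)"
      using aB by (intro sum_norm_le) (simp add: mult_left_mono)
    also have "\<dots> < e / 2" by (rule M[OF N])
    finally show ?thesis
      using 1 norm_triangle_ineq[of "seq_mean N f x - (\<Sum>j\<in>?J. w j *\<^sub>R a j)" "(\<Sum>j\<in>?J. w j *\<^sub>R a j) - I"]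
      by (simp add: dist_norm)
  qed
  then show "\<exists>M. \<forall>N\<ge>M. dist (seq_mean N f x) (LINT x:unit_cube|lebesgue. f x) < e"
    unfolding I_def by blast
qed

section \<open>Weighted suprema and the spectral test\<close>

lemma norm_seq_mean_le:
  assumes "\<And>n. norm (f (x n)) \<le> B" "B \<ge> 0"
  shows "norm (seq_mean N f x) \<le> B"
proof -
  have "norm (\<Sum>n<N. f (x n)) \<le> (\<Sum>n<N. B)"
    using assms by (intro sum_norm_le) auto
  then show ?thesis
    using assms(2) by (cases "N = 0") (auto simp: seq_mean_def norm_mult norm_divide field_simps)
qed

text \<open>The all-ones vector is a witness, since 1 belongs to each of the three admissible
  factors.\<close>

lemma index_set_minus_zero_nonempty:
  fixes \<Lambda> :: "(int ^ 's) set"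
  assumes "index_set \<Lambda>"
  shows "\<Lambda> - {0} \<noteq> {}"
proof -
  obtain A where A: "\<forall>i. A i \<in> {UNIV, {0..}, {1..}}" "\<Lambda> = {k. \<forall>i. k $ i \<in> A i}"
    using assms unfolding index_set_def by (elim exE conjE) (rule that)
  have "1 \<in> A i" for i
  proof -
    have "A i = UNIV \<or> A i = {0..} \<or> A i = {1..}"
      using spec[OF A(1), of i] by (simp only: insert_iff empty_iff simp_thms)
    then show ?thesis by (elim disjE) simp_all
  qed
  then have "1 \<in> \<Lambda>"
    unfolding A(2) by simp
  moreover have "(1 :: int ^ 's) \<noteq> 0"
    by (simp add: vec_eq_iff)
  ultimately show ?thesis by blast
qed

text \<open>Each term is at most the supremum, so dividing by its weight gives one direction.
  Conversely, only finitely many weights exceed a given level, and the remaining terms are small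
  uniformly in \<open>N\<close>.\<close>

lemma weighted_sup_tendsto_zero_iff:
  fixes g :: "nat \<Rightarrow> 'a \<Rightarrow> 'b::real_normed_vector" and \<rho> :: "'a \<Rightarrow> real"
  assumes ne: "S \<noteq> {}" and pos: "\<And>k. k \<in> S \<Longrightarrow> \<rho> k > 0"
    and fin: "\<And>e. e > 0 \<Longrightarrow> finite {k \<in> S. \<rho> k \<ge> e}"
    and le1: "\<And>N k. k \<in> S \<Longrightarrow> norm (g N k) \<le> 1"
  shows "(\<lambda>N. SUP k\<in>S. \<rho> k * norm (g N k)) \<longlonglongrightarrow> 0 \<longleftrightarrow> (\<forall>k\<in>S. (\<lambda>N. g N k) \<longlonglongrightarrow> 0)"
proof -
  have "\<exists>k\<in>S. (\<forall>l\<in>S. \<rho> l \<le> \<rho> k) \<and> (SUP l\<in>S. \<rho> l) = \<rho> k"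
    by (rule attains_max_of_finite_superlevels[OF ne less_imp_le[OF pos] fin])
  then obtain k0 where k0: "k0 \<in> S" "\<And>l. l \<in> S \<Longrightarrow> \<rho> l \<le> \<rho> k0" by blast
  have le: "\<rho> k * norm (g N k) \<le> \<rho> k" if "k \<in> S" for k N
    using le1[OF that] pos[OF that] by (simp add: mult_left_le)
  have bdd: "bdd_above ((\<lambda>k. \<rho> k * norm (g N k)) ` S)" for N
    using le k0(2) order_trans by (intro bdd_aboveI2[where M = "\<rho> k0"]) blast
  have nn: "0 \<le> (SUP k\<in>S. \<rho> k * norm (g N k))" for N
  proof -
    have "0 \<le> \<rho> k0 * norm (g N k0)" using pos[OF k0(1)] by simp
    also have "\<dots> \<le> (SUP k\<in>S. \<rho> k * norm (g N k))" by (rule cSUP_upper[OF k0(1) bdd])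
    finally show ?thesis .
  qed
  show ?thesis
  proof
    assume lim: "(\<lambda>N. SUP k\<in>S. \<rho> k * norm (g N k)) \<longlonglongrightarrow> 0"
    show "\<forall>k\<in>S. (\<lambda>N. g N k) \<longlonglongrightarrow> 0"
    proof
      fix k assume k: "k \<in> S"
      have "(\<lambda>N. inverse (\<rho> k) * (SUP k\<in>S. \<rho> k * norm (g N k))) \<longlonglongrightarrow> inverse (\<rho> k) * 0"
        by (intro tendsto_mult_left lim)
      then have lim': "(\<lambda>N. inverse (\<rho> k) * (SUP k\<in>S. \<rho> k * norm (g N k))) \<longlonglongrightarrow> 0" by simp
      have "norm (g N k) \<le> inverse (\<rho> k) * (SUP k\<in>S. \<rho> k * norm (g N k))" for N
        using cSUP_upper[OF k bdd, of N] pos[OF k] by (simp add: field_simps)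
      then show "(\<lambda>N. g N k) \<longlonglongrightarrow> 0"
        by (intro Lim_null_comparison[OF _ lim'] always_eventually) blast
    qed
  next
    assume lim: "\<forall>k\<in>S. (\<lambda>N. g N k) \<longlonglongrightarrow> 0"
    show "(\<lambda>N. SUP k\<in>S. \<rho> k * norm (g N k)) \<longlonglongrightarrow> 0"
    proof (rule metric_LIMSEQ_I)
      fix e :: real assume e: "e > 0"
      have "\<forall>k\<in>S. \<forall>\<^sub>F N in sequentially. \<rho> k * norm (g N k) < e / 2"
      proof
        fix k assume "k \<in> S"
        then have "(\<lambda>N. \<rho> k * norm (g N k)) \<longlonglongrightarrow> \<rho> k * norm (0 :: 'b)"
          using lim by (intro tendsto_intros) blast
        then show "\<forall>\<^sub>F N in sequentially. \<rho> k * norm (g N k) < e / 2"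
          using e by (intro order_tendstoD) auto
      qed
      \<comment> \<open>Convergence for each index becomes uniform over the finite set of heavy
        indices.\<close>
      then have "\<forall>\<^sub>F N in sequentially. \<forall>k\<in>{k \<in> S. \<rho> k \<ge> e / 2}. \<rho> k * norm (g N k) < e / 2"
        using e by (intro eventually_ball_finite fin) auto
      then obtain M where M: "\<And>N k. N \<ge> M \<Longrightarrow> k \<in> S \<Longrightarrow> \<rho> k \<ge> e / 2 \<Longrightarrow> \<rho> k * norm (g N k) < e / 2"
        unfolding eventually_sequentially by blast
      have "(SUP k\<in>S. \<rho> k * norm (g N k)) \<le> e / 2" if "N \<ge> M" for N
      proof (rule cSUP_least[OF ne])
        fix k assume k: "k \<in> S"
        \<comment> \<open>A light index, of weight below \<open>e / 2\<close>, needs no limit: its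
          term never exceeds its weight.\<close>
        show "\<rho> k * norm (g N k) \<le> e / 2"
          using M[OF that k] le[OF k, of N] by (cases "\<rho> k \<ge> e / 2") auto
      qed
      then have "dist (SUP k\<in>S. \<rho> k * norm (g N k)) 0 < e" if "N \<ge> M" for N
        using nn[of N] e that by (force simp: dist_norm)
      then show "\<exists>M. \<forall>N\<ge>M. dist (SUP k\<in>S. \<rho> k * norm (g N k)) 0 < e" by blast
    qed
  qed
qed

theorem theorem4p6:
  fixes \<Lambda> :: "(int ^ 's) set"
    and \<xi> :: "int ^ 's \<Rightarrow> real ^ 's \<Rightarrow> complex"
    and \<nu> :: "real ^ 's \<Rightarrow> real"
    and \<rho> :: "int ^ 's \<Rightarrow> real"
    and \<omega> :: "nat \<Rightarrow> real ^ 's"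
  assumes "index_set \<Lambda>"
    and "udd_function_system \<Lambda> \<xi>"
    and "is_norm \<nu>"
    and "weight_function \<nu> \<Lambda> \<rho>"
    and "range \<omega> \<subseteq> unit_cube"
  shows "(\<forall>N\<ge>1. \<exists>k\<in>\<Lambda> - {0}.
            (\<forall>l\<in>\<Lambda> - {0}. \<rho> l * norm (seq_mean N (\<xi> l) \<omega>) \<le> \<rho> k * norm (seq_mean N (\<xi> k) \<omega>)) \<and>
            (SUP l\<in>\<Lambda> - {0}. \<rho> l * norm (seq_mean N (\<xi> l) \<omega>)) = \<rho> k * norm (seq_mean N (\<xi> k) \<omega>))
       \<and> (uniformly_distributed \<omega> \<longleftrightarrow> (\<lambda>N. spectral_test \<Lambda> \<xi> \<rho> N \<omega>) \<longlonglongrightarrow> 0)"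
proof -
  let ?S = "\<Lambda> - {0}"
  let ?h = "\<lambda>N k. \<rho> k * norm (seq_mean N (\<xi> k) \<omega>)"
  have ne: "?S \<noteq> {}" by (rule index_set_minus_zero_nonempty[OF assms(1)])
  have pos: "\<rho> k > 0" if "k \<in> ?S" for k
    using assms(4) that unfolding weight_function_def by blast
  have fin: "finite {k \<in> ?S. \<rho> k \<ge> e}" if "e > 0" for e
    by (rule finite_subset[OF _ weight_function_finite_ge[OF assms(3,4) that]]) blast
  have bound: "norm (\<xi> k y) \<le> 1" if "k \<in> ?S" "y \<in> unit_cube" for k y
    using assms(2) that unfolding udd_function_system_def by blast
  have le1: "norm (seq_mean N (\<xi> k) \<omega>) \<le> 1" if "k \<in> ?S" for N k
    using bound[OF that] assms(5) by (intro norm_seq_mean_le) auto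
  \<comment> \<open>Means of norm at most 1 place the superlevel sets of the weighted means inside
    those of \<open>\<rho>\<close>.\<close>
  have finh: "finite {k \<in> ?S. ?h N k \<ge> e}" if "e > 0" for N e
  proof (rule finite_subset[OF _ fin[OF that]], safe)
    fix k assume k: "k \<in> \<Lambda>" "k \<noteq> 0" "e \<le> ?h N k"
    then have "?h N k \<le> \<rho> k"
      using le1[of k N] pos[of k] by (intro mult_left_le) auto
    then show "e \<le> \<rho> k" using k(3) by linarith
  qed
  have 1: "\<exists>k\<in>?S. (\<forall>l\<in>?S. ?h N l \<le> ?h N k) \<and> (SUP l\<in>?S. ?h N l) = ?h N k" for N
  proof (rule attains_max_of_finite_superlevels[OF ne _ finh])
    show "0 \<le> ?h N k" if "k \<in> ?S" for k
      using pos[OF that] by simp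
  qed
  have "\<exists>k\<in>?S. (\<forall>l\<in>?S. \<rho> l \<le> \<rho> k) \<and> (SUP l\<in>?S. \<rho> l) = \<rho> k"
    by (rule attains_max_of_finite_superlevels[OF ne less_imp_le[OF pos] fin])
  then obtain k0 where k0: "k0 \<in> ?S" "(SUP k\<in>?S. \<rho> k) = \<rho> k0" by blast
  have "(SUP k\<in>?S. \<rho> k) \<noteq> 0" unfolding k0(2) using pos[OF k0(1)] by (rule less_imp_neq[symmetric])
  then have "inverse (SUP k\<in>?S. \<rho> k) \<noteq> 0"
    by (rule nonzero_imp_inverse_nonzero)
  then have "(\<lambda>N. spectral_test \<Lambda> \<xi> \<rho> N \<omega>) \<longlonglongrightarrow> 0 \<longleftrightarrow> (\<lambda>N. SUP k\<in>?S. ?h N k) \<longlonglongrightarrow> 0"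
    unfolding spectral_test_def by (rule tendsto_mult_left_iff[where l = 0, unfolded mult_zero_right])
  also have "\<dots> \<longleftrightarrow> (\<forall>k\<in>?S. (\<lambda>N. seq_mean N (\<xi> k) \<omega>) \<longlonglongrightarrow> 0)"
    by (rule weighted_sup_tendsto_zero_iff[OF ne pos fin le1])
  \<comment> \<open>One direction is the defining property of the function system; the other is
    convergence of means to the integral, which is 0 for nonzero indices.\<close>
  also have "\<dots> \<longleftrightarrow> uniformly_distributed \<omega>"
  proof
    assume "\<forall>k\<in>?S. (\<lambda>N. seq_mean N (\<xi> k) \<omega>) \<longlonglongrightarrow> 0"
    then show "uniformly_distributed \<omega>"
      using assms(2,5) unfolding udd_function_system_def by blast
  next
    assume ud: "uniformly_distributed \<omega>"
    show "\<forall>k\<in>?S. (\<lambda>N. seq_mean N (\<xi> k) \<omega>) \<longlonglongrightarrow> 0"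
    proof
      fix k assume k: "k \<in> ?S"
      then have "Riemann_integrable_unit_cube (\<xi> k)" "(LINT x:unit_cube|lebesgue. \<xi> k x) = 0"
        using assms(2) unfolding udd_function_system_def by blast+
      then show "(\<lambda>N. seq_mean N (\<xi> k) \<omega>) \<longlonglongrightarrow> 0"
        using uniformly_distributed_mean_tendsto[where f = "\<xi> k", OF ud assms(5) _ bound[OF k]] by simp
    qed
  qed
  finally have 2: "uniformly_distributed \<omega> \<longleftrightarrow> (\<lambda>N. spectral_test \<Lambda> \<xi> \<rho> N \<omega>) \<longlonglongrightarrow> 0"
    by (rule sym)
  show ?thesis
    by (intro conjI allI impI 1 2)
qed

end
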